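(* Let $S$ be a finite thin MC left regular band with adjacency graph $\Gamma_{\mathcal C}$. Then $\Gamma_{\mathcal C}$ is an edge-labeled graph such that: (i) for every simple cycle $\Gamma$ in $\Gamma_{\mathcal C}$ and every element $s$ of the support lattice, the number of edges of $\Gamma$ whose label $x$ satisfies $\operatorname{supp}(x)=s$ is even; and (ii) each label appears on exactly one edge of $\Gamma_{\mathcal C}$.
   Context: A left regular band is a semigroup $S$ with $x^2=x$ and $xyx=xy$ for all $x,y\in S$. Its face poset is $(S,\le)$ with $y\le x$ iff $yx=x$ (a partial order). Chambers are the maximal elements of $(S,\le)$; $\mathcal C$ is the set of chambers. "$x$ is covered by $y$" means $x<y$ with nothing strictly between. A facet is an element covered by some chamber. Support: define the preorder $x\preceq y$ iff $yx=y$; the support lattice is the associated quotient poset and $\operatorname{supp}$ is the quotient map, so $\operatorname{supp}(x)\le\operatorname{supp}(y)$ iff $yx=y$, and $\operatorname{supp}(x)=\operatorname{supp}(y)$ iff $xy=x$ and $yx=y$; one has $\operatorname{supp}(xy)=\operatorname{supp}(x)\vee\operatorname{supp}(y)$. Adjacency graph $\Gamma_{\mathcal C}$ of a finite left regular band: the vertices are the chambers, and for each $x\in S$ and each pair of distinct chambers $C\ne C'$ both covering $x$ there is an edge labeled $x$ between $C$ and $C'$. A left regular band is MC if its face poset is a meet-semilattice (any two elements have a greatest lower bound) and its adjacency graph is connected. An MC left regular band is thin if for every facet $a$ there are exactly two chambers $C$ with $a\le C$. A simple cycle is a closed path with no repeated vertices other than the first and last, and of length at least $3$. *)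

theory Defs
  imports Main
begin

text \<open>Undirected graphs with labeled edges. An edge is a pair of a label and the set of its two
  end points, so parallel edges with different labels are allowed.\<close>

record ('v, 'l) lgraph =
  verts :: "'v set"
  edges :: "('l \<times> 'v set) set"

abbreviation label :: "'l \<times> 'v set \<Rightarrow> 'l" where "label \<equiv> fst"
abbreviation ends :: "'l \<times> 'v set \<Rightarrow> 'v set" where "ends \<equiv> snd"

definition edge_labeled_graph :: "('v, 'l) lgraph \<Rightarrow> bool" where
  "edge_labeled_graph G \<longleftrightarrow> (\<forall>e\<in>edges G. ends e \<subseteq> verts G \<and> card (ends e) = 2)"

definition labels :: "('v, 'l) lgraph \<Rightarrow> 'l set" where
  "labels G = label ` edges G"

text \<open>A path records its edges as well as its vertices, since vertices alone do not determine
  the edges when there are parallel ones.\<close>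

definition is_path :: "('v, 'l) lgraph \<Rightarrow> 'v list \<Rightarrow> ('l \<times> 'v set) list \<Rightarrow> bool" where
  "is_path G vs es \<longleftrightarrow> length vs = Suc (length es) \<and> set vs \<subseteq> verts G \<and>
     (\<forall>i<length es. es ! i \<in> edges G \<and> ends (es ! i) = {vs ! i, vs ! Suc i})"

definition connected_graph :: "('v, 'l) lgraph \<Rightarrow> bool" where
  "connected_graph G \<longleftrightarrow>
     (\<forall>u\<in>verts G. \<forall>v\<in>verts G. \<exists>vs es. is_path G vs es \<and> hd vs = u \<and> last vs = v)"

text \<open>The first vertex is repeated at the end of \<open>vs\<close>, so dropping it leaves each vertex of the
  cycle once.\<close>

definition simple_cycle :: "('v, 'l) lgraph \<Rightarrow> 'v list \<Rightarrow> ('l \<times> 'v set) list \<Rightarrow> bool" where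
  "simple_cycle G vs es \<longleftrightarrow>
     is_path G vs es \<and> hd vs = last vs \<and> distinct (tl vs) \<and> 3 \<le> length es"


locale left_regular_band =
  fixes S :: "'a set" and mult :: "'a \<Rightarrow> 'a \<Rightarrow> 'a"  (infixl \<open>\<cdot>\<close> 70)
  assumes closed: "x \<in> S \<Longrightarrow> y \<in> S \<Longrightarrow> x \<cdot> y \<in> S"
    and assoc: "x \<in> S \<Longrightarrow> y \<in> S \<Longrightarrow> z \<in> S \<Longrightarrow> (x \<cdot> y) \<cdot> z = x \<cdot> (y \<cdot> z)"
    and idem: "x \<in> S \<Longrightarrow> x \<cdot> x = x"
    and left_regular: "x \<in> S \<Longrightarrow> y \<in> S \<Longrightarrow> x \<cdot> y \<cdot> x = x \<cdot> y"
begin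

definition face_le :: "'a \<Rightarrow> 'a \<Rightarrow> bool"  (infix \<open>\<sqsubseteq>\<close> 50) where
  "y \<sqsubseteq> x \<longleftrightarrow> y \<cdot> x = x"

definition face_less :: "'a \<Rightarrow> 'a \<Rightarrow> bool"  (infix \<open>\<sqsubset>\<close> 50) where
  "y \<sqsubset> x \<longleftrightarrow> y \<sqsubseteq> x \<and> y \<noteq> x"

definition covered_by :: "'a \<Rightarrow> 'a \<Rightarrow> bool" where
  "covered_by x y \<longleftrightarrow> x \<in> S \<and> y \<in> S \<and> x \<sqsubset> y \<and> \<not> (\<exists>z\<in>S. x \<sqsubset> z \<and> z \<sqsubset> y)"

definition chambers :: "'a set" where
  "chambers = {C \<in> S. \<forall>x\<in>S. C \<sqsubseteq> x \<longrightarrow> x = C}"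

definition facets :: "'a set" where
  "facets = {a \<in> S. \<exists>C\<in>chambers. covered_by a C}"

definition supp_le :: "'a \<Rightarrow> 'a \<Rightarrow> bool"  (infix \<open>\<preceq>\<close> 50) where
  "x \<preceq> y \<longleftrightarrow> y \<cdot> x = y"

definition supp_rel :: "('a \<times> 'a) set" where
  "supp_rel = {(x, y). x \<in> S \<and> y \<in> S \<and> x \<preceq> y \<and> y \<preceq> x}"

definition support_lattice :: "'a set set" where
  "support_lattice = S // supp_rel"

definition supp :: "'a \<Rightarrow> 'a set" where
  "supp x = supp_rel `` {x}"

definition adjacency_graph :: "('a, 'a) lgraph" where
  "adjacency_graph =
     \<lparr> verts = chambers,
       edges = {(x, {C, C'}) | x C C'. x \<in> S \<and> C \<in> chambers \<and> C' \<in> chambers \<and> C \<noteq> C' \<and>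
                  covered_by x C \<and> covered_by x C'} \<rparr>"

lemma supp_le_trans:
  assumes "x \<in> S" "y \<in> S" "z \<in> S" "x \<preceq> y" "y \<preceq> z"
  shows "x \<preceq> z"
  using assms unfolding supp_le_def by (metis assoc)

lemma equiv_supp_rel: "equiv S supp_rel"
proof (rule equivI)
  show "supp_rel \<subseteq> S \<times> S" by (auto simp: supp_rel_def)
  show "refl_on S supp_rel" by (auto simp: refl_on_def supp_rel_def supp_le_def idem)
  show "sym supp_rel" by (auto simp: sym_def supp_rel_def)
  show "trans supp_rel" unfolding trans_def supp_rel_def by (auto intro: supp_le_trans)
qed

lemma supp_eq_iff:
  assumes "x \<in> S" "y \<in> S"
  shows "supp x = supp y \<longleftrightarrow> x \<cdot> y = x \<and> y \<cdot> x = y"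
  unfolding supp_def eq_equiv_class_iff[OF equiv_supp_rel assms]
  using assms by (auto simp: supp_rel_def supp_le_def)

end

locale MC_left_regular_band = left_regular_band +
  assumes meet_semilattice: "x \<in> S \<Longrightarrow> y \<in> S \<Longrightarrow>
      \<exists>m\<in>S. m \<sqsubseteq> x \<and> m \<sqsubseteq> y \<and> (\<forall>z\<in>S. z \<sqsubseteq> x \<and> z \<sqsubseteq> y \<longrightarrow> z \<sqsubseteq> m)"
    and connected: "connected_graph adjacency_graph"

locale thin_MC_left_regular_band = MC_left_regular_band +
  assumes thin: "a \<in> facets \<Longrightarrow> card {C \<in> chambers. a \<sqsubseteq> C} = 2"

end

theory Submission imports Defs begin

text \<open>A label \<open>a\<close> is a facet, so by thinness the two ends of an edge labeled \<open>a\<close> are the only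
  chambers above \<open>a\<close>; this gives (ii). For (i), fix a label \<open>a\<close> and send each chamber \<open>D\<close> to
  \<open>a \<cdot> D\<close>, the end of the edge of \<open>a\<close> that lies on the same side as \<open>D\<close>. This map tells the ends
  of an edge labeled \<open>x\<close> apart exactly when \<open>x\<close> has the same support as \<open>a\<close>. Hence a closed path
  crosses such edges an even number of times.\<close>

section \<open>Parity along lists and closed paths\<close>

text \<open>With at most two values available, each change of \<open>g\<close> is a switch to the
  other value, so only the parity of the number of changes decides whether the last value equals the
  first.\<close>

lemma even_card_changes_iff:
  assumes "\<And>i. i < n \<Longrightarrow> P i \<longleftrightarrow> g i \<noteq> g (Suc i)"
    and "\<And>i. i \<le> n \<Longrightarrow> g i \<in> {p, q}"
  shows "even (card {i. i < n \<and> P i}) \<longleftrightarrow> g 0 = g n"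
  using assms
proof (induction n)
  case 0
  then show ?case by simp
next
  case (Suc n)
  have IH: "even (card {i. i < n \<and> P i}) \<longleftrightarrow> g 0 = g n"
    using Suc.prems by (intro Suc.IH) auto
  have vals: "g 0 \<in> {p, q}" "g n \<in> {p, q}" "g (Suc n) \<in> {p, q}"
    using Suc.prems(2) by auto
  have change: "P n \<longleftrightarrow> g n \<noteq> g (Suc n)"
    using Suc.prems(1) by simp
  show ?case
  proof (cases "P n")
    case True
    then have "{i. i < Suc n \<and> P i} = insert n {i. i < n \<and> P i}"
      by (auto simp: less_Suc_eq)
    then have "card {i. i < Suc n \<and> P i} = Suc (card {i. i < n \<and> P i})"
      by simp
    moreover have "g 0 = g n \<longleftrightarrow> g 0 \<noteq> g (Suc n)"
      using change True vals unfolding insert_iff empty_iff by metis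
    ultimately show ?thesis using IH by (simp only: even_Suc) blast
  next
    case False
    then have "{i. i < Suc n \<and> P i} = {i. i < n \<and> P i}"
      by (auto simp: less_Suc_eq)
    then show ?thesis using IH change False by metis
  qed
qed

text \<open>Positions and entries correspond one to one without repetitions. This carries the parity
  of positions along a path over to the edge set of a cycle.\<close>

lemma card_set_filter_nth:
  assumes "distinct xs"
  shows "card {x \<in> set xs. P x} = card {i. i < length xs \<and> P (xs ! i)}"
proof -
  have "{x \<in> set xs. P x} = (!) xs ` {i. i < length xs \<and> P (xs ! i)}"
    by (auto simp: in_set_conv_nth)
  moreover have "inj_on ((!) xs) {i. i < length xs \<and> P (xs ! i)}"
    using assms by (auto simp: inj_on_def nth_eq_iff_index_eq)
  ultimately show ?thesis by (simp add: card_image)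
qed

lemma is_path_closed_nth:
  assumes "is_path G vs es" "hd vs = last vs"
  shows "vs ! 0 = vs ! length es"
proof -
  have "length vs = Suc (length es)" using assms(1) by (simp add: is_path_def)
  moreover then have "vs \<noteq> []" by auto
  ultimately show ?thesis using assms(2) by (simp add: hd_conv_nth last_conv_nth)
qed

text \<open>A repeated edge would have to be run through in opposite directions at consecutive
  positions, which closes the path after two steps.\<close>

lemma simple_cycle_distinct_edges:
  assumes "simple_cycle G vs es"
  shows "distinct es"
proof -
  have path: "is_path G vs es" and "hd vs = last vs"
    and dist: "distinct (tl vs)" and len3: "3 \<le> length es"
    using assms by (auto simp: simple_cycle_def)
  have len: "length vs = Suc (length es)"
    and ends: "\<And>i. i < length es \<Longrightarrow> ends (es ! i) = {vs ! i, vs ! Suc i}"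
    using path by (auto simp: is_path_def)
  have inj: "vs ! Suc i = vs ! Suc j \<longleftrightarrow> i = j" if "i < length es" "j < length es" for i j
    using nth_eq_iff_index_eq[OF dist, of i j] that len by (simp add: nth_tl)
  have closed: "vs ! 0 = vs ! length es"
    by (rule is_path_closed_nth) fact+
  have "es ! i \<noteq> es ! j" if "i < j" "j < length es" for i j
  proof
    assume "es ! i = es ! j"
    then have "{vs ! i, vs ! Suc i} = {vs ! j, vs ! Suc j}"
      using ends[of i] ends[of j] that by simp
    moreover have "vs ! Suc i \<noteq> vs ! Suc j"
      using inj[of i j] that by simp
    ultimately have i: "vs ! i = vs ! Suc j" and j: "vs ! Suc i = vs ! j"
      by (auto simp: doubleton_eq_iff)
    \<comment> \<open>Injectivity is known only for positions from 1 on, hence the predecessor of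
      \<open>j\<close>.\<close>
    obtain j' where j': "j = Suc j'" using \<open>i < j\<close> by (cases j) simp_all
    then have "j = Suc i" using inj[of i j'] j that by simp
    show False
    \<comment> \<open>Position 0 lies outside \<open>tl vs\<close>; closedness replaces it by the
      last position, which would force length 2.\<close>
    proof (cases i)
      case 0
      obtain n where n: "length es = Suc n" using len3 by (cases "length es") auto
      then have "vs ! Suc n = vs ! Suc j" using i closed 0 by simp
      then have "n = j" using inj[of n j] n that by simp
      then show False using n len3 \<open>j = Suc i\<close> 0 by simp
    next
      case (Suc i')
      then show False using inj[of i' j] i that by simp
    qed
  qed
  then show ?thesis
    unfolding distinct_conv_nth by (metis linorder_neqE_nat)
qed

section \<open>Products with chambers\<close>

context left_regular_band
begin

lemma mult_face_le: "x \<in> S \<Longrightarrow> y \<in> S \<Longrightarrow> x \<sqsubseteq> x \<cdot> y"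
  unfolding face_le_def by (metis assoc idem)

text \<open>The product lies above \<open>C\<close>, and \<open>C\<close> is maximal.\<close>

lemma chamber_mult:
  assumes "C \<in> chambers" "y \<in> S"
  shows "C \<cdot> y = C"
  using assms mult_face_le[of C y] closed by (auto simp: chambers_def)

text \<open>Any \<open>z\<close> above \<open>x \<cdot> C\<close> equals
  \<open>x \<cdot> (C \<cdot> z)\<close>, and \<open>C\<close> absorbs \<open>z\<close>.\<close>

lemma mult_chamber:
  assumes "x \<in> S" "C \<in> chambers"
  shows "x \<cdot> C \<in> chambers"
proof -
  have C: "C \<in> S" using assms by (simp add: chambers_def)
  have "z = x \<cdot> C" if "z \<in> S" "x \<cdot> C \<sqsubseteq> z" for z
    using that assms C chamber_mult[of C z] assoc[of x C z] by (simp add: face_le_def)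
  then show ?thesis using assms C closed by (auto simp: chambers_def)
qed

lemma edges_adjacency_graph_iff:
  "(x, e) \<in> edges adjacency_graph \<longleftrightarrow> (\<exists>C C'. e = {C, C'} \<and> x \<in> S \<and> C \<in> chambers \<and>
     C' \<in> chambers \<and> C \<noteq> C' \<and> covered_by x C \<and> covered_by x C')"
  by (auto simp: adjacency_graph_def)

lemma edge_labeled_graph_adjacency_graph: "edge_labeled_graph adjacency_graph"
  by (auto simp: edge_labeled_graph_def adjacency_graph_def)

end

section \<open>Facets with two chambers and the separation of chambers\<close>

context thin_MC_left_regular_band
begin

lemma edge_ends_eq_chambers_above:
  assumes "(a, e) \<in> edges adjacency_graph"
  shows "e = {C \<in> chambers. a \<sqsubseteq> C}"
proof -
  obtain C C' where e: "e = {C, C'}" and CC: "a \<in> S" "C \<in> chambers" "C' \<in> chambers" "C \<noteq> C'"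
    "covered_by a C" "covered_by a C'"
    using assms by (auto simp: edges_adjacency_graph_iff)
  then have "a \<in> facets" by (auto simp: facets_def)
  then have two: "card {C \<in> chambers. a \<sqsubseteq> C} = 2" by (rule thin)
  \<comment> \<open>An infinite set has \<open>card\<close> 0, so cardinality 2 already yields
    finiteness.\<close>
  then have "finite {C \<in> chambers. a \<sqsubseteq> C}" by (metis card.infinite zero_neq_numeral)
  moreover have "e \<subseteq> {C \<in> chambers. a \<sqsubseteq> C}"
    using e CC by (auto simp: covered_by_def face_less_def)
  moreover have "card e = 2" using e CC by simp
  ultimately show ?thesis using two by (metis card_subset_eq)
qed

lemma mult_in_edge_ends:
  assumes "(a, e) \<in> edges adjacency_graph" "D \<in> chambers"
  shows "a \<cdot> D \<in> e"
proof -
  have "a \<in> S" "D \<in> S"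
    using assms by (auto simp: edges_adjacency_graph_iff chambers_def)
  then show ?thesis
    unfolding edge_ends_eq_chambers_above[OF assms(1)]
    using assms(2) mult_face_le mult_chamber by simp
qed

text \<open>The product \<open>z \<cdot> D\<close> is a chamber above \<open>a\<close>, hence an end
  of the edge, and so it covers \<open>a\<close>. As \<open>z\<close> lies strictly above
  \<open>a\<close> and below \<open>z \<cdot> D\<close>, the two coincide.\<close>

lemma above_label_is_chamber:
  assumes e: "(a, e) \<in> edges adjacency_graph" and z: "z \<in> S" "a \<sqsubset> z"
    and D: "D \<in> chambers"
  shows "z \<cdot> D = z"
proof -
  have S: "a \<in> S" "D \<in> S"
    using e D by (auto simp: edges_adjacency_graph_iff chambers_def)
  have "a \<cdot> (z \<cdot> D) = z \<cdot> D"
    using S z assoc[of a z D] by (simp add: face_less_def face_le_def)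
  then have "z \<cdot> D \<in> e"
    using mult_in_edge_ends[OF e mult_chamber[OF z(1) D]] by simp
  then have "covered_by a (z \<cdot> D)"
    using e by (auto simp: edges_adjacency_graph_iff)
  moreover have "z \<sqsubseteq> z \<cdot> D" using mult_face_le z S by simp
  ultimately show ?thesis using z by (auto simp: covered_by_def face_less_def)
qed

lemma label_separates_iff:
  assumes e: "(a, e) \<in> edges adjacency_graph" and d: "(x, {D, D'}) \<in> edges adjacency_graph"
  shows "supp x = supp a \<longleftrightarrow> a \<cdot> D \<noteq> a \<cdot> D'"
proof -
  have a: "a \<in> S" and x: "x \<in> S" and D: "D \<in> chambers" "D' \<in> chambers"
    and le: "x \<sqsubseteq> D" "x \<sqsubseteq> D'" and ne: "D \<noteq> D'"
    using e d edge_ends_eq_chambers_above[OF d]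
    by (auto simp: edges_adjacency_graph_iff doubleton_eq_iff)
  have DS: "D \<in> S" "D' \<in> S" using D by (auto simp: chambers_def)
  have eq: "x \<cdot> D = D" "x \<cdot> D' = D'" using le by (auto simp: face_le_def)
  have aD: "a \<cdot> x \<cdot> D = a \<cdot> D" "a \<cdot> x \<cdot> D' = a \<cdot> D'"
    using assoc[of a x] a x DS eq by auto
  show ?thesis
  proof
    assume "supp x = supp a"
    then have "x \<cdot> a = x" using supp_eq_iff x a by simp
    \<comment> \<open>Left multiplication by \<open>x\<close> recovers \<open>D\<close> and
      \<open>D'\<close> from their images, so the images differ.\<close>
    then have "x \<cdot> (a \<cdot> D) = D" "x \<cdot> (a \<cdot> D') = D'"
      using assoc[of x a] x a DS eq by auto
    then show "a \<cdot> D \<noteq> a \<cdot> D'" using ne by metis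
  next
    assume sep: "a \<cdot> D \<noteq> a \<cdot> D'"
    \<comment> \<open>Otherwise \<open>a \<cdot> x\<close> is strictly above \<open>a\<close> and
      absorbs both chambers, so both images equal \<open>a \<cdot> x\<close>.\<close>
    have ax: "a \<cdot> x = a"
    proof (rule ccontr)
      assume "a \<cdot> x \<noteq> a"
      then have "a \<sqsubset> a \<cdot> x" using mult_face_le a x by (simp add: face_less_def)
      then show False
        using above_label_is_chamber[OF e] D closed[OF a x] aD sep by metis
    qed
    have "x \<cdot> a = x"
    proof (rule ccontr)
      assume "x \<cdot> a \<noteq> x"
      then have "x \<sqsubset> x \<cdot> a" using mult_face_le a x by (simp add: face_less_def)
      \<comment> \<open>The same absorption, now for the edge labeled \<open>x\<close>. Since
        \<open>a = a \<cdot> (x \<cdot> a)\<close>, it passes on to \<open>a\<close>, which then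
        sends every chamber to \<open>a\<close> and separates nothing.\<close>
      then have xa: "x \<cdot> a \<cdot> C = x \<cdot> a" if "C \<in> chambers" for C
        using above_label_is_chamber[OF d] that closed[OF x a] by metis
      have "a \<cdot> C = a" if "C \<in> chambers" for C
      proof -
        have C: "C \<in> S" using that by (simp add: chambers_def)
        have "a \<cdot> C = a \<cdot> (x \<cdot> a) \<cdot> C"
          using assoc[of a x a] a x ax idem by simp
        also have "\<dots> = a \<cdot> (x \<cdot> a)"
          using assoc[of a "x \<cdot> a" C] closed[OF x a] a C xa[OF that] by simp
        also have "\<dots> = a" using assoc[of a x a] a x ax idem by simp
        finally show ?thesis .
      qed
      then show False using sep D by metis
    qed
    then show "supp x = supp a" using supp_eq_iff x a ax by simp
  qed
qed

lemma even_closed_path_crossings: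
  assumes path: "is_path adjacency_graph vs es" and closed: "hd vs = last vs"
  shows "even (card {i. i < length es \<and> supp (label (es ! i)) = s})"
proof (cases "\<exists>k < length es. supp (label (es ! k)) = s")
  case False
  then have "{i. i < length es \<and> supp (label (es ! i)) = s} = {}" by auto
  then show ?thesis by (simp only: card.empty even_zero)
next
  case True
  then obtain k where k: "k < length es" and s: "supp (label (es ! k)) = s" by blast
  \<comment> \<open>The reference label comes from the path itself, so it belongs to an edge and has
    support \<open>s\<close>.\<close>
  define a where "a = label (es ! k)"
  have ed: "(label (es ! i), {vs ! i, vs ! Suc i}) \<in> edges adjacency_graph"
    if "i < length es" for i
    using path that unfolding is_path_def by (metis prod.collapse)
  have verts: "vs ! i \<in> chambers" if "i \<le> length es" for i
    using path that nth_mem[of i vs]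
    by (auto simp: is_path_def adjacency_graph_def)
  have e: "(a, {vs ! k, vs ! Suc k}) \<in> edges adjacency_graph"
    using ed k a_def by simp
  have "even (card {i. i < length es \<and> supp (label (es ! i)) = s}) \<longleftrightarrow>
      a \<cdot> vs ! 0 = a \<cdot> vs ! length es"
  proof (rule even_card_changes_iff)
    show "supp (label (es ! i)) = s \<longleftrightarrow> a \<cdot> vs ! i \<noteq> a \<cdot> vs ! Suc i" if "i < length es" for i
      using label_separates_iff[OF e ed[OF that]] s a_def by simp
    show "a \<cdot> vs ! i \<in> {a \<cdot> vs ! k, a \<cdot> vs ! Suc k}" if "i \<le> length es" for i
    proof -
      \<comment> \<open>Both ends are fixed by \<open>a\<close>, so they are the two possible values
        of the map.\<close>
      have fix_ends: "a \<cdot> C = C" if "C \<in> {vs ! k, vs ! Suc k}" for C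
        using edge_ends_eq_chambers_above[OF e] that by (auto simp: face_le_def)
      show ?thesis
        using mult_in_edge_ends[OF e verts[OF that]] fix_ends by simp
    qed
  qed
  then show ?thesis using is_path_closed_nth[OF path closed] by simp
qed

end

theorem theorem3p14:
  fixes S :: "'a set" and mult :: "'a \<Rightarrow> 'a \<Rightarrow> 'a"
  assumes "finite S"
    and "thin_MC_left_regular_band S mult"
  shows "edge_labeled_graph (left_regular_band.adjacency_graph S mult) \<and>
    (\<forall>vs es. simple_cycle (left_regular_band.adjacency_graph S mult) vs es \<longrightarrow>
      (\<forall>s \<in> left_regular_band.support_lattice S mult.
        even (card {e \<in> set es. left_regular_band.supp S mult (label e) = s}))) \<and>
    (\<forall>x \<in> labels (left_regular_band.adjacency_graph S mult).
      \<exists>!e. e \<in> edges (left_regular_band.adjacency_graph S mult) \<and> label e = x)"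
proof -
  interpret thin_MC_left_regular_band S mult by fact
  show ?thesis
  proof (intro conjI allI impI ballI)
    show "edge_labeled_graph adjacency_graph"
      by (rule edge_labeled_graph_adjacency_graph)
  next
    fix vs es s
    assume cyc: "simple_cycle adjacency_graph vs es"
    then show "even (card {e \<in> set es. supp (label e) = s})"
      using even_closed_path_crossings[of vs es s]
      by (simp add: card_set_filter_nth[OF simple_cycle_distinct_edges[OF cyc]] simple_cycle_def)
  next
    fix x
    assume "x \<in> labels adjacency_graph"
    then obtain e where e: "(x, e) \<in> edges adjacency_graph"
      by (auto simp: labels_def)
    show "\<exists>!e. e \<in> edges adjacency_graph \<and> label e = x"
    proof (rule ex1I[of _ "(x, e)"])
      \<comment> \<open>The label determines the set of ends, namely all chambers above it.\<close>
      show "d = (x, e)" if "d \<in> edges adjacency_graph \<and> label d = x" for d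
        using that edge_ends_eq_chambers_above[of x "ends d"] edge_ends_eq_chambers_above[OF e]
        by (metis prod.collapse)
    qed (use e in simp)
  qed
qed

end
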